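(* Let $(X,d,\mu)$ be an $s$-Ahlfors-regular quasi-metric measure space, and let $1<q\le\infty$ and $v>-1$. Then $$\mathscr B^{0,v}_q(X)\subseteq L(\log^+L)^{1+v}(X).$$ Moreover, if $\mu(X)<\infty$, then $$\mathscr B^{0,v}_q(X)=L(\log^+L)^{1+v}(X).$$
   Context: An $s$-Ahlfors-regular quasi-metric measure space $(X,d,\mu)$ is a set $X$ with a function $d:X\times X\to[0,\infty)$ such that $d(x,y)=d(y,x)$; $d(x,y)=0$ iff $x=y$; and for some constant $A\ge 1$, $d(x,y)\le A(d(x,z)+d(z,y))$ for all $x,y,z\in X$; together with a nonzero Borel regular measure $\mu$ on $X$ for which there are constants $c,C,s>0$ with $$c\,r^s\le\mu(B(x,r))\le C\,r^s,\qquad x\in X,\ 0<r<\operatorname{diam}(X),$$ where $B(x,r)=\{y\in X:d(x,y)<r\}$ and $\operatorname{diam}(X)=\sup\{d(x,y):x,y\in X\}\in[0,\infty]$. Write $\log^+t=\max\{\log t,0\}$. For $k\ge0$, $v>-1$, $t>0$ set $\phi_{k,v}(t)=\chi_{(0,1)}(t)\int_t^1 s^{-1-k}(\log^+(1/s))^v\,ds$; in particular $\phi_{0,v}(t)=\frac1{1+v}(\log^+(1/t))^{1+v}$. Generalized $q$-block: for $1<q\le\infty$, a measurable function $a$ on $X$ is a generalized $q$-block (supported on $E$) if $E\subset X$ is a measurable set with $0<\mu(E)<\infty$, $\operatorname{supp}a\subseteq E$ (i.e. $a$ vanishes outside $E$), and $\|a\|_{L^q(E)}\le\mu(E)^{1/q-1}$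 (with $1/\infty=0$). Generalized block space $\mathscr B^{0,v}_q(X)$: all $f\in L^1(X)$ admitting a decomposition $f=\sum_{j=1}^\infty\lambda_ja_j$ with $\lambda_j\in\mathbb C$, each $a_j$ a generalized $q$-block supported on a measurable set $E_j$, and $\sum_{j=1}^\infty|\lambda_j|(1+\phi_{0,v}(\mu(E_j)))<\infty$. (Since $\|a_j\|_{L^1}\le1$, the series converges absolutely in $L^1(X)$.) Orlicz-type space: for $\beta>0$, $L(\log^+L)^\beta(X)$ is the set of measurable $f$ on $X$ with $\int_X|f|(\log(2+|f|))^\beta\,d\mu<\infty$. *)

theory Defs
  imports "HOL-Analysis.Analysis" "HOL-Probability.Essential_Supremum"
begin

definition quasi_metric_on :: "'a set \<Rightarrow> ('a \<Rightarrow> 'a \<Rightarrow> real) \<Rightarrow> bool" where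
  "quasi_metric_on X d \<longleftrightarrow>
     (\<forall>x\<in>X. \<forall>y\<in>X. 0 \<le> d x y \<and> d x y = d y x \<and> (d x y = 0 \<longleftrightarrow> x = y)) \<and>
     (\<exists>A\<ge>1. \<forall>x\<in>X. \<forall>y\<in>X. \<forall>z\<in>X. d x y \<le> A * (d x z + d z y))"

definition qball :: "'a set \<Rightarrow> ('a \<Rightarrow> 'a \<Rightarrow> real) \<Rightarrow> 'a \<Rightarrow> real \<Rightarrow> 'a set" where
  "qball X d x r = {y \<in> X. d x y < r}"

definition qdiam :: "'a set \<Rightarrow> ('a \<Rightarrow> 'a \<Rightarrow> real) \<Rightarrow> ennreal" where
  "qdiam X d = (SUP (x, y) \<in> X \<times> X. ennreal (d x y))"

text \<open>The topology of a quasi-metric: a set is open if it contains a ball around each of its points.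
  The balls themselves need not be open, nor even Borel.\<close>

definition qopen :: "'a set \<Rightarrow> ('a \<Rightarrow> 'a \<Rightarrow> real) \<Rightarrow> 'a set \<Rightarrow> bool" where
  "qopen X d U \<longleftrightarrow> U \<subseteq> X \<and> (\<forall>x\<in>U. \<exists>r>0. qball X d x r \<subseteq> U)"

definition qborel_sets :: "'a set \<Rightarrow> ('a \<Rightarrow> 'a \<Rightarrow> real) \<Rightarrow> 'a set set" where
  "qborel_sets X d = sigma_sets X {U. qopen X d U}"

definition borel_regular :: "'a measure \<Rightarrow> ('a \<Rightarrow> 'a \<Rightarrow> real) \<Rightarrow> bool" where
  "borel_regular M d \<longleftrightarrow>
     qborel_sets (space M) d \<subseteq> sets M \<and>
     (\<forall>A\<in>sets M. \<exists>B\<in>qborel_sets (space M) d. A \<subseteq> B \<and> emeasure M B = emeasure M A)"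

text \<open>The carrier is \<open>space M\<close>. Since balls need not be measurable, their measure is taken in
  the sense of the outer measure induced by \<open>M\<close>. This is \<open>emeasure M\<close> on measurable balls; and if \<open>M\<close>
  is the restriction of a Borel regular outer measure (one for which every subset has a Borel hull
  of the same measure) to its measurable sets, it is that outer measure.\<close>

definition ahlfors_regular_space :: "'a measure \<Rightarrow> ('a \<Rightarrow> 'a \<Rightarrow> real) \<Rightarrow> real \<Rightarrow> bool" where
  "ahlfors_regular_space M d s \<longleftrightarrow>
     quasi_metric_on (space M) d \<and>
     borel_regular M d \<and>
     emeasure M (space M) \<noteq> 0 \<and>
     s > 0 \<and>
     (\<exists>c>0. \<exists>C>0. \<forall>x\<in>space M. \<forall>r>0. ennreal r < qdiam (space M) d \<longrightarrow>
        ennreal (c * r powr s) \<le> outer_measure_of M (qball (space M) d x r) \<and>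
        outer_measure_of M (qball (space M) d x r) \<le> ennreal (C * r powr s))"

definition ln_plus :: "real \<Rightarrow> real" where
  "ln_plus t = max (ln t) 0"

definition phi :: "real \<Rightarrow> real \<Rightarrow> real \<Rightarrow> real" where
  "phi k v t =
     indicator {0<..<1} t * (LINT s:{t..1}|lborel. s powr (-1 - k) * ln_plus (1 / s) powr v)"

definition Lq_norm :: "'a measure \<Rightarrow> ennreal \<Rightarrow> ('a \<Rightarrow> complex) \<Rightarrow> ennreal" where
  "Lq_norm M q f =
     (if q = \<infinity> then esssup M (\<lambda>x. ennreal (norm (f x)))
      else let I = (\<integral>\<^sup>+x. ennreal (norm (f x) powr enn2real q) \<partial>M)
           in if I = \<infinity> then \<infinity> else ennreal (enn2real I powr (1 / enn2real q)))"

text \<open>In \<open>ennreal\<close>, \<open>1 / \<infinity> = 0\<close>.\<close>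

definition generalized_block :: "'a measure \<Rightarrow> ennreal \<Rightarrow> 'a set \<Rightarrow> ('a \<Rightarrow> complex) \<Rightarrow> bool" where
  "generalized_block M q E a \<longleftrightarrow>
     a \<in> borel_measurable M \<and>
     E \<in> sets M \<and> 0 < emeasure M E \<and> emeasure M E < \<infinity> \<and>
     (\<forall>x\<in>space M - E. a x = 0) \<and>
     Lq_norm (restrict_space M E) q a \<le> ennreal (measure M E powr (enn2real (1 / q) - 1))"

text \<open>Both function spaces below are sets of functions rather than of almost-everywhere classes;
  the values of the functions outside \<open>space M\<close> are irrelevant. The series
  \<open>f = (\<Sum>j. \<lambda>\<^sub>j a\<^sub>j)\<close> is understood in \<open>L\<^sup>1\<close>.\<close>

definition block_space :: "'a measure \<Rightarrow> ennreal \<Rightarrow> real \<Rightarrow> ('a \<Rightarrow> complex) set" where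
  "block_space M q v =
     {f. integrable M f \<and>
         (\<exists>(l :: nat \<Rightarrow> complex) a E.
            (\<forall>j. generalized_block M q (E j) (a j)) \<and>
            summable (\<lambda>j. norm (l j) * (1 + phi 0 v (measure M (E j)))) \<and>
            (\<lambda>n. \<integral>\<^sup>+x. ennreal (norm (f x - (\<Sum>j<n. l j * a j x))) \<partial>M) \<longlonglongrightarrow> 0)}"

definition L_log_L :: "'a measure \<Rightarrow> real \<Rightarrow> ('a \<Rightarrow> complex) set" where
  "L_log_L M \<beta> =
     {f \<in> borel_measurable M.
        (\<integral>\<^sup>+x. ennreal (norm (f x) * ln (2 + norm (f x)) powr \<beta>) \<partial>M) < \<infinity>}"

end

theory Submission
  imports Defs
begin

text \<open>A block \<open>a\<close> on a set of measure \<open>m\<close> has the form \<open>u / m\<close> with \<open>u\<close> bounded in \<open>L\<^sup>q\<close> of the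
  normalised measure, and \<open>ln (2 + u / m)\<close> is at most \<open>ln (2 + u) + ln\<^sup>+ (1 / m) + ln 2\<close>. So the
  \<open>L log L\<close> integral of \<open>a\<close> is at most a multiple of \<open>1 + phi 0 v m\<close>, and these integrals can be summed
  against the coefficients. Conversely, on a space of finite measure a function in \<open>L log L\<close> is cut
  along its dyadic level sets; the pieces, divided by \<open>2 ^ k\<close> times the measure \<open>m\<close> of the level set, are
  blocks. In the resulting coefficient sum, \<open>ln (1 / m)\<close> is either \<open>O(k)\<close>, which is controlled by
  \<open>ln (2 + \<bar>f\<bar>)\<close> on the level set, or \<open>m\<close> is so small that the terms are dominated by a geometric
  series.\<close>

section \<open>The function \<open>phi\<close> in closed form and elementary logarithm
  estimates\<close>

text \<open>For \<open>t < 1\<close> the integrand has the antiderivative \<open>F\<close>. When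
  \<open>v < 0\<close> the integrand blows up at 1, so the fundamental theorem is applied on the
  open interval with one-sided limits of \<open>F\<close> at the ends; \<open>v > -1\<close> makes
  the limit at 1 vanish. For \<open>t \<ge> 1\<close> both sides are 0.\<close>

lemma phi_zero_eq:
  assumes v: "-1 < v" and t: "0 < t"
  shows "phi 0 v t = ln_plus (1 / t) powr (1 + v) / (1 + v)"
proof (cases "t < 1")
  case False
  then show ?thesis using t v by (simp add: phi_def ln_plus_def ln_div)
next
  case True
  define f where "f = (\<lambda>s::real. s powr (-1) * ln_plus (1 / s) powr v)"
  define F where "F = (\<lambda>s::real. - ((- ln s) powr (1 + v) / (1 + v)))"
  have lnp: "ln_plus (1 / s) = - ln s" if "0 < s" "s \<le> 1" for s :: real
    using that by (auto simp: ln_plus_def ln_div)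
  have deriv: "(F has_real_derivative f s) (at s)" if "t < s" "s < 1" for s
  proof -
    have "0 < s" "ln s < 0" using that t by auto
    then show ?thesis
      unfolding F_def f_def using that v
      by (auto intro!: derivative_eq_intros simp: lnp powr_minus divide_simps)
  qed
  have cont: "isCont f s" if "t < s" "s < 1" for s
  proof -
    have "0 < s" "ln s < 0" using that t by auto
    then have "isCont (\<lambda>s. s powr (-1) * (- ln s) powr v) s"
      by (auto intro!: continuous_intros)
    moreover have "eventually (\<lambda>z. f z = z powr (-1) * (- ln z) powr v) (nhds s)"
      using eventually_nhds_in_open[of "{0<..<1}" s] that t
      by (auto elim!: eventually_mono simp: f_def lnp)
    ultimately show ?thesis by (simp add: isCont_cong)
  qed
  have tend_t: "(F \<longlongrightarrow> F t) (at_right t)"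
  proof -
    have "isCont F t" unfolding F_def using t True v by (auto intro!: continuous_intros)
    then show ?thesis by (simp add: isCont_def filterlim_at_split)
  qed
  have tend_1: "(F \<longlongrightarrow> 0) (at_left 1)"
  proof -
    have "((\<lambda>s::real. - ln s) \<longlongrightarrow> 0) (at_left 1)"
      by (auto intro!: tendsto_eq_intros)
    moreover have "eventually (\<lambda>s::real. 0 \<le> - ln s) (at_left 1)"
      using eventually_at_left_real[of 0 "1::real"] by (auto elim!: eventually_mono)
    ultimately have "((\<lambda>s::real. (- ln s) powr (1 + v)) \<longlongrightarrow> 0) (at_left 1)"
      using tendsto_powr'[of "\<lambda>s. - ln s" 0 "at_left (1::real)" "\<lambda>_. 1 + v" "1 + v"] v by auto
    then have "((\<lambda>s::real. - ((- ln s) powr (1 + v) / (1 + v))) \<longlongrightarrow> - (0 / (1 + v))) (at_left 1)"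
      using v by (intro tendsto_intros) auto
    then show ?thesis by (simp add: F_def)
  qed
  have "(LBINT s=ereal t..ereal 1. f s) = 0 - F t"
  proof (rule interval_integral_FTC_nonneg)
    show "((F \<circ> real_of_ereal) \<longlongrightarrow> F t) (at_right (ereal t))"
      using tend_t by (simp add: ereal_tendsto_simps)
    show "((F \<circ> real_of_ereal) \<longlongrightarrow> 0) (at_left (ereal 1))"
      using tend_1 by (simp add: ereal_tendsto_simps)
  qed (use deriv cont True in \<open>auto simp: f_def\<close>)
  then show ?thesis
    using True t by (simp add: interval_integral_Icc phi_def f_def F_def lnp)
qed

text \<open>Bounding the sum by twice the maximum covers exponents below 1 as well, where
  \<open>powr\<close> is not convex.\<close>

lemma powr_add_le:
  fixes x y r :: real
  assumes "0 \<le> x" "0 \<le> y" "0 \<le> r"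
  shows "(x + y) powr r \<le> 2 powr r * (x powr r + y powr r)"
proof -
  have "(x + y) powr r \<le> (2 * max x y) powr r"
    by (rule powr_mono2) (use assms in auto)
  also have "\<dots> = 2 powr r * max x y powr r"
    using assms by (simp add: powr_mult)
  also have "\<dots> \<le> 2 powr r * (x powr r + y powr r)"
    by (intro mult_left_mono) (auto simp: max_def)
  finally show ?thesis .
qed

text \<open>This is \<open>ln x \<le> x powr r / r\<close> with \<open>r = e / b\<close>, raised to
  the power \<open>b\<close>.\<close>

lemma ln_powr_le_powr:
  fixes x b e :: real
  assumes "1 \<le> x" "0 < b" "0 < e"
  shows "ln x powr b \<le> (b / e) powr b * x powr e"
proof -
  have "ln x \<le> x powr (e / b) / (e / b)"
    using assms by (intro ln_powr_bound) auto
  then have "ln x powr b \<le> ((b / e) * x powr (e / b)) powr b"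
    using assms by (intro powr_mono2) (auto simp: field_simps)
  also have "\<dots> = (b / e) powr b * x powr e"
    using assms by (subst powr_mult) (auto simp: powr_powr)
  finally show ?thesis .
qed

text \<open>Since \<open>2 + c * (u / m)\<close> is at most
  \<open>(2 + u) * (2 + c) * (1 + 1 / m)\<close>, its logarithm splits into a sum. The part
  \<open>ln (2 + u)\<close> is absorbed by \<open>u powr (p - 1)\<close>, and the factor
  \<open>u\<close> in front raises this to \<open>u powr p\<close>. The dilation \<open>c\<close>
  provides for the argument \<open>c * t j\<close> that arises when a series of blocks is
  summed.\<close>

lemma log_rescaling_bound:
  fixes b p c :: real
  assumes b: "0 < b" and p: "1 < p" and c: "0 \<le> c"
  obtains K where "0 \<le> K"
    "\<And>u m. 0 \<le> u \<Longrightarrow> 0 < m \<Longrightarrow>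
       u * ln (2 + c * (u / m)) powr b \<le> K * (1 + ln_plus (1 / m) powr b) * (1 + u powr p)"
proof -
  \<comment> \<open>\<open>H\<close> is the constant in the power bound for
    \<open>ln (2 + u) powr b\<close>. \<open>A\<close> collects the logarithms of
    \<open>2 + c\<close> and of the 2 in \<open>2 * exp l\<close>. The leading 2 in \<open>K\<close>
    pays for \<open>u + u powr p \<le> 2 * (1 + u powr p)\<close>.\<close>
  define H where "H = (b / (p - 1)) powr b * 2 powr (p - 1) * (2 powr (p - 1) + 1)"
  define A where "A = ln (2 + c) + ln 2"
  define K where "K = 2 * 2 powr b * (H + 2 powr b * (A powr b + 1))"
  have A: "0 \<le> A" using c by (simp add: A_def)
  have H: "0 \<le> H" by (simp add: H_def)
  have K: "0 \<le> K" using H by (simp add: K_def)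
  have main: "u * ln (2 + c * (u / m)) powr b \<le> K * (1 + ln_plus (1 / m) powr b) * (1 + u powr p)"
    if u: "0 \<le> u" and m: "0 < m" for u m
  proof -
    define l where "l = ln_plus (1 / m)"
    have l: "0 \<le> l" by (simp add: l_def ln_plus_def)
    have P: "1 + 1 / m \<le> 2 * exp l"
    proof -
      have "1 / m \<le> exp l"
        using m by (metis exp_le_cancel_iff exp_ln l_def ln_plus_def max.cobounded1 zero_less_divide_1_iff)
      then show ?thesis using l by (smt (verit) one_le_exp_iff)
    qed
    have "2 + c * (u / m) \<le> (2 + u) * (2 + c) * (1 + 1 / m)"
      using u m c by (simp add: field_simps)
    also have "\<dots> \<le> (2 + u) * (2 + c) * (2 * exp l)"
      using u c P by (intro mult_left_mono) auto
    finally have "ln (2 + c * (u / m)) \<le> ln ((2 + u) * (2 + c) * (2 * exp l))"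
      using u m c by (intro ln_mono) (auto intro: add_pos_nonneg)
    also have "\<dots> = ln (2 + u) + (A + l)"
      using u c by (simp add: ln_mult A_def)
    finally have 1: "ln (2 + c * (u / m)) \<le> ln (2 + u) + (A + l)" .
    have "(2 + u) powr (p - 1) \<le> 2 powr (p - 1) * (2 powr (p - 1) + u powr (p - 1))"
      using u p by (intro powr_add_le) auto
    also have "\<dots> \<le> 2 powr (p - 1) * ((2 powr (p - 1) + 1) * (1 + u powr (p - 1)))"
      by (intro mult_left_mono) (auto simp: algebra_simps)
    finally have "(b / (p - 1)) powr b * (2 + u) powr (p - 1) \<le> H * (1 + u powr (p - 1))"
      unfolding H_def mult.assoc by (intro mult_left_mono) auto
    then have 2: "ln (2 + u) powr b \<le> H * (1 + u powr (p - 1))"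
      using ln_powr_le_powr[of "2 + u" b "p - 1"] u b p by simp
    have "ln (2 + c * (u / m)) powr b \<le> (ln (2 + u) + (A + l)) powr b"
      using 1 u c m b by (intro powr_mono2) auto
    also have "\<dots> \<le> 2 powr b * (ln (2 + u) powr b + (A + l) powr b)"
      using u A l b by (intro powr_add_le) auto
    also have "\<dots> \<le> 2 powr b * (H * (1 + u powr (p - 1)) + 2 powr b * (A powr b + l powr b))"
      using 2 A l b by (intro mult_left_mono add_mono powr_add_le) auto
    also have "\<dots> \<le> 2 powr b * ((H + 2 powr b * (A powr b + 1)) * ((1 + u powr (p - 1)) * (1 + l powr b)))"
    proof (intro mult_left_mono)
      have "1 + u powr (p - 1) \<le> (1 + u powr (p - 1)) * (1 + l powr b)"
        by (auto simp: algebra_simps)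
      then have "H * (1 + u powr (p - 1)) \<le> H * ((1 + u powr (p - 1)) * (1 + l powr b))"
        using H by (rule mult_left_mono)
      moreover have "A powr b + l powr b \<le> (A powr b + 1) * ((1 + u powr (p - 1)) * (1 + l powr b))"
        by (auto simp: algebra_simps)
      then have "2 powr b * (A powr b + l powr b) \<le> 2 powr b * ((A powr b + 1) * ((1 + u powr (p - 1)) * (1 + l powr b)))"
        by (rule mult_left_mono) auto
      ultimately show "H * (1 + u powr (p - 1)) + 2 powr b * (A powr b + l powr b)
          \<le> (H + 2 powr b * (A powr b + 1)) * ((1 + u powr (p - 1)) * (1 + l powr b))"
        unfolding distrib_right[of H] mult.assoc by (rule add_mono)
    qed auto
    also have "\<dots> = K / 2 * (1 + l powr b) * (1 + u powr (p - 1))"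
      by (simp add: K_def)
    finally have "u * ln (2 + c * (u / m)) powr b \<le> u * (K / 2 * (1 + l powr b) * (1 + u powr (p - 1)))"
      using u by (rule mult_left_mono)
    also have "\<dots> = K / 2 * (1 + l powr b) * (u + u powr p)"
      using u p by (cases "u = 0") (auto simp: algebra_simps powr_mult_base)
    also have "\<dots> \<le> K / 2 * (1 + l powr b) * (2 * (1 + u powr p))"
    proof (intro mult_left_mono)
      have "u \<le> 1 + u powr p"
      proof (cases "u \<le> 1")
        case False
        then have "u powr 1 \<le> u powr p" using p by (intro powr_mono) auto
        then show ?thesis using False by simp
      qed (simp add: add_increasing2)
      then show "u + u powr p \<le> 2 * (1 + u powr p)" by (simp add: add_increasing2)
    qed (use K in auto)
    also have "\<dots> = K * (1 + l powr b) * (1 + u powr p)" by simp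
    finally show ?thesis unfolding l_def .
  qed
  show thesis by (rule that[OF K main])
qed

section \<open>Logarithmic integrals of a single block\<close>

lemma enn2real_one_divide: "enn2real (1 / q) = 1 / enn2real q" if "0 < q"
proof (cases q)
  case (real r)
  with that have "0 < r" by auto
  then show ?thesis using real by (simp add: divide_ennreal flip: ennreal_1)
qed (simp)

lemma generalized_block_emeasure:
  assumes "generalized_block M q E a"
  shows "emeasure M E = ennreal (measure M E)" "0 < measure M E"
proof -
  show "emeasure M E = ennreal (measure M E)"
    using assms by (intro emeasure_eq_ennreal_measure) (auto simp: generalized_block_def)
  then show "0 < measure M E"
    using assms by (simp add: generalized_block_def)
qed

text \<open>The case \<open>q = \<infinity>\<close> is reduced to the exponent 2.\<close>

lemma block_power_integral:
  assumes blk: "generalized_block M q E a" and q: "1 < q"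
    and p: "p = (if q = \<infinity> then 2 else enn2real q)"
  shows "(\<integral>\<^sup>+x. ennreal ((measure M E * norm (a x)) powr p) * indicator E x \<partial>M) \<le> emeasure M E"
proof -
  define m where "m = measure M E"
  have E[measurable]: "E \<in> sets M" and a[measurable]: "a \<in> borel_measurable M"
    and norm: "Lq_norm (restrict_space M E) q a \<le> ennreal (m powr (enn2real (1 / q) - 1))"
    and em: "emeasure M E = ennreal m" and m: "0 < m"
    using blk generalized_block_emeasure[OF blk] by (simp_all add: generalized_block_def m_def)
  have ar[measurable]: "a \<in> borel_measurable (restrict_space M E)"
    using a by (rule measurable_restrict_space1)
  have Er: "E \<inter> space M \<in> sets M" by simp
  have "(\<integral>\<^sup>+x. ennreal ((m * norm (a x)) powr p) * indicator E x \<partial>M) \<le> ennreal m"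
  proof (cases "q = \<infinity>")
    case True
    have le: "esssup (restrict_space M E) (\<lambda>x. ennreal (norm (a x))) \<le> ennreal (m powr - 1)"
      using norm True by (simp add: Lq_norm_def)
    have "AE x in restrict_space M E. ennreal (norm (a x)) \<le> esssup (restrict_space M E) (\<lambda>x. ennreal (norm (a x)))"
      by (rule esssup_AE) 
    then have "AE x in restrict_space M E. ennreal (norm (a x)) \<le> ennreal (m powr - 1)"
      by eventually_elim (rule order_trans[OF _ le])
    then have "AE x in M. x \<in> E \<longrightarrow> ennreal (norm (a x)) \<le> ennreal (m powr - 1)"
      by (simp add: AE_restrict_space_iff Er)
    then have "AE x in M. ennreal ((m * norm (a x)) powr p) * indicator E x \<le> indicator E x"
    proof eventually_elim
      case (elim x)
      show ?case
      proof (cases "x \<in> E")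
        case True
        with elim have "norm (a x) \<le> 1 / m" using m by (auto simp: powr_minus divide_simps)
        then have "m * norm (a x) \<le> 1" using m by (simp add: field_simps)
        then have "(m * norm (a x)) powr p \<le> 1 powr p" using m p \<open>q = \<infinity>\<close> by (intro powr_mono2) auto
        then show ?thesis by (simp add: ennreal_le_1 True)
      qed auto
    qed
    then have "(\<integral>\<^sup>+x. ennreal ((m * norm (a x)) powr p) * indicator E x \<partial>M) \<le> (\<integral>\<^sup>+x. indicator E x \<partial>M)"
      by (rule nn_integral_mono_AE)
    then show ?thesis by (simp add: em)
  next
    case False
    then have pq: "p = enn2real q" using p by simp
    have p1: "1 < p" using q False pq by (cases q) auto
    define I where "I = (\<integral>\<^sup>+x. ennreal (norm (a x) powr p) \<partial>restrict_space M E)"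
    have q0: "0 < q" using q by (meson less_trans zero_less_one)
    \<comment> \<open>\<open>Lq_norm\<close> is infinite whenever the integral is, so the finite
      bound excludes \<open>I = \<infinity>\<close> and \<open>enn2real I\<close> loses
      nothing.\<close>
    have I: "I \<noteq> \<infinity>" and "ennreal (enn2real I powr (1 / p)) \<le> ennreal (m powr (1 / p - 1))"
      using norm False unfolding Lq_norm_def Let_def pq[symmetric] I_def[symmetric]
      by (auto simp: enn2real_one_divide q0 pq top_unique split: if_splits)
    then have "enn2real I powr (1 / p) \<le> m powr (1 / p - 1)" by simp
    then have "(enn2real I powr (1 / p)) powr p \<le> (m powr (1 / p - 1)) powr p"
      using p1 by (intro powr_mono2) auto
    then have "enn2real I \<le> m powr (1 - p)"
      using p1 by (simp add: powr_powr left_diff_distrib)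
    then have "I \<le> ennreal (m powr (1 - p))"
      using I by (metis ennreal_enn2real ennreal_leI infinity_ennreal_def less_top)
    then have "ennreal (m powr p) * I \<le> ennreal (m powr p) * ennreal (m powr (1 - p))"
      by (rule mult_left_mono) simp
    also have "\<dots> = ennreal m"
      using m by (simp add: ennreal_mult[symmetric] powr_add[symmetric])
    finally show ?thesis
      using m by (simp add: I_def nn_integral_restrict_space Er powr_mult ennreal_mult
          nn_integral_cmult mult.assoc)
  qed
  then show ?thesis by (simp add: em m_def)
qed

text \<open>With \<open>u = m * norm (a x)\<close>, the integrand is at most
  \<open>B * (1 + u powr p)\<close> on \<open>E\<close>. The integral of \<open>1 + u powr p\<close>
  over \<open>E\<close> is at most \<open>2 * m\<close>, which cancels the \<open>1 / m\<close> in
  \<open>B\<close>. \<open>K\<close> is fixed before \<open>M\<close>, \<open>E\<close> and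
  \<open>a\<close>, so that one constant serves all blocks of a decomposition.\<close>

lemma block_L_log_L_bound:
  assumes q: "1 < q" and v: "-1 < v" and c: "0 \<le> c"
  obtains K where "0 \<le> K"
    "\<And>(M :: 'a measure) E a. generalized_block M q E a \<Longrightarrow>
       (\<integral>\<^sup>+x. ennreal (norm (a x) * ln (2 + c * norm (a x)) powr (1 + v)) \<partial>M)
         \<le> ennreal (K * (1 + phi 0 v (measure M E)))"
proof -
  define b where "b = 1 + v"
  define p where "p = (if q = \<infinity> then 2 else enn2real q)"
  have b: "0 < b" using v by (simp add: b_def)
  have p1: "1 < p" using q by (cases q) (auto simp: p_def)
  obtain K where K: "0 \<le> K" and bound: "\<And>u m. 0 \<le> u \<Longrightarrow> 0 < m \<Longrightarrow>
       u * ln (2 + c * (u / m)) powr b \<le> K * (1 + ln_plus (1 / m) powr b) * (1 + u powr p)"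
    using log_rescaling_bound[OF b p1 c] by blast
  have main: "(\<integral>\<^sup>+x. ennreal (norm (a x) * ln (2 + c * norm (a x)) powr (1 + v)) \<partial>M)
         \<le> ennreal (2 * K * (1 + b) * (1 + phi 0 v (measure M E)))"
    if blk: "generalized_block M q E a" for M :: "'a measure" and E a
  proof -
    define m where "m = measure M E"
    have E[measurable]: "E \<in> sets M" and a[measurable]: "a \<in> borel_measurable M"
      and out: "\<And>x. x \<in> space M \<Longrightarrow> x \<notin> E \<Longrightarrow> a x = 0"
      and em: "emeasure M E = ennreal m" and m: "0 < m"
      using blk generalized_block_emeasure[OF blk] by (simp_all add: generalized_block_def m_def)
    define B where "B = K * (1 + ln_plus (1 / m) powr b) / m"
    have B: "0 \<le> B" using K m by (simp add: B_def)
    have pt: "ennreal (norm (a x) * ln (2 + c * norm (a x)) powr (1 + v))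
        \<le> ennreal B * (indicator E x + ennreal ((m * norm (a x)) powr p) * indicator E x)"
      if "x \<in> space M" for x
    proof (cases "x \<in> E")
      case True
      have "norm (a x) * ln (2 + c * norm (a x)) powr b = (m * norm (a x)) * ln (2 + c * (m * norm (a x) / m)) powr b / m"
        using m by simp
      also have "\<dots> \<le> K * (1 + ln_plus (1 / m) powr b) * (1 + (m * norm (a x)) powr p) / m"
        using m by (intro divide_right_mono bound) auto
      also have "\<dots> = B * (1 + (m * norm (a x)) powr p)" by (simp add: B_def)
      finally show ?thesis using True B
        by (simp add: b_def ennreal_mult[symmetric] flip: ennreal_1 ennreal_plus)
    qed (use out that in simp)
    have "(\<integral>\<^sup>+x. ennreal (norm (a x) * ln (2 + c * norm (a x)) powr (1 + v)) \<partial>M)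
        \<le> (\<integral>\<^sup>+x. ennreal B * (indicator E x + ennreal ((m * norm (a x)) powr p) * indicator E x) \<partial>M)"
      by (intro nn_integral_mono pt)
    also have "\<dots> = ennreal B * (emeasure M E + (\<integral>\<^sup>+x. ennreal ((m * norm (a x)) powr p) * indicator E x \<partial>M))"
      by (simp add: nn_integral_cmult nn_integral_add)
    also have "\<dots> \<le> ennreal B * (emeasure M E + emeasure M E)"
      unfolding m_def by (intro mult_left_mono add_left_mono block_power_integral[OF blk q p_def]) auto
    also have "\<dots> = ennreal (B * (m + m))"
      using B m by (simp only: em ennreal_mult ennreal_plus add_nonneg_nonneg less_imp_le)
    also have "B * (m + m) = 2 * K * (1 + ln_plus (1 / m) powr b)"
      using m by (simp add: B_def)
    also have "\<dots> \<le> ennreal (2 * K * (1 + b) * (1 + phi 0 v m))"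
    \<comment> \<open>The factor \<open>1 + b\<close> makes up for the division by
      \<open>1 + v\<close> in the closed form of \<open>phi\<close>.\<close>
    proof (intro ennreal_leI)
      have "ln_plus (1 / m) powr b = b * phi 0 v m" "0 \<le> phi 0 v m"
        using b by (simp_all add: phi_zero_eq[OF v m] b_def)
      then have "1 + ln_plus (1 / m) powr b \<le> (1 + b) * (1 + phi 0 v m)"
        using b by (simp add: algebra_simps)
      then have "2 * K * (1 + ln_plus (1 / m) powr b) \<le> 2 * K * ((1 + b) * (1 + phi 0 v m))"
        using K by (intro mult_left_mono) auto
      then show "2 * K * (1 + ln_plus (1 / m) powr b) \<le> 2 * K * (1 + b) * (1 + phi 0 v m)"
        by (simp add: mult.assoc)
    qed
    finally show ?thesis by (simp add: m_def)
  qed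
  show thesis by (rule that[of "2 * K * (1 + b)"]) (use K b main in auto)
qed

section \<open>Summing blocks: the inclusion into L log L\<close>

text \<open>The terms with \<open>c * t j < F\<close> contribute at most \<open>F / 2\<close> to the sum, so they can be dropped
  at the cost of a factor 2. This replaces Jensen's inequality and requires no convexity.\<close>

lemma mult_mono_fun_le_suminf:
  fixes F :: real and w t :: "nat \<Rightarrow> real" and g :: "real \<Rightarrow> real"
  assumes F: "0 \<le> F" and w: "\<And>j. 0 \<le> w j" "summable w" and t: "\<And>j. 0 \<le> t j"
    and le: "ennreal F \<le> (\<Sum>j. ennreal (w j * t j))"
    and g: "\<And>x. 0 \<le> x \<Longrightarrow> 0 \<le> g x" "\<And>x y. 0 \<le> x \<Longrightarrow> x \<le> y \<Longrightarrow> g x \<le> g y"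
    and c: "c = 2 * (1 + suminf w)"
  shows "ennreal (F * g F) \<le> 2 * (\<Sum>j. ennreal (w j * (t j * g (c * t j))))"
proof -
  \<comment> \<open>The summand 1 in \<open>c\<close> keeps it positive even if all weights vanish;
    the factor 2 gives \<open>suminf w \<le> c / 2\<close>, whence the bound \<open>F / 2\<close>
    for the dropped terms.\<close>
  have c0: "0 < c" using w c suminf_nonneg[OF w(2,1)] by simp
  define R where "R = (\<Sum>j. ennreal (if F \<le> c * t j then w j * t j else 0))"
  have "ennreal F \<le> (\<Sum>j. ennreal (w j * (F / c)) + ennreal (if F \<le> c * t j then w j * t j else 0))"
  proof (rule order_trans[OF le suminf_le])
    fix j
    show "ennreal (w j * t j) \<le> ennreal (w j * (F / c)) + ennreal (if F \<le> c * t j then w j * t j else 0)"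
    proof (cases "F \<le> c * t j")
      case False
      then have "t j \<le> F / c" using c0 by (simp add: field_simps)
      then have "w j * t j \<le> w j * (F / c)" using w(1) by (rule mult_left_mono)
      then show ?thesis using False by (auto intro!: ennreal_leI)
    qed simp
  qed auto
  also have "\<dots> = (\<Sum>j. ennreal (w j * (F / c))) + R"
    unfolding R_def by (rule suminf_add[symmetric]) auto
  also have "(\<Sum>j. ennreal (w j * (F / c))) = ennreal (suminf w * (F / c))"
    unfolding suminf_mult2[OF w(2)]
    by (rule suminf_ennreal2) (use w F c0 in \<open>auto intro!: summable_mult2 simp del: times_divide_eq_right\<close>)
  also have "\<dots> \<le> ennreal (F / 2)"
  proof (rule ennreal_leI)
    have "suminf w * F \<le> c / 2 * F" using F c by (intro mult_right_mono) auto
    then show "suminf w * (F / c) \<le> F / 2" using c0 by (simp add: field_simps)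
  qed
  finally have "ennreal (F / 2) + ennreal (F / 2) \<le> ennreal (F / 2) + R"
    using F by (simp flip: ennreal_plus)
  then have "ennreal (F / 2) \<le> R" by (simp add: ennreal_add_left_cancel_le)
  then have "ennreal (2 * g F) * ennreal (F / 2) \<le> ennreal (2 * g F) * R"
    by (rule mult_left_mono) simp
  also have "\<dots> = 2 * (\<Sum>j. ennreal (g F) * ennreal (if F \<le> c * t j then w j * t j else 0))"
    unfolding R_def using g(1)[OF F] by (simp add: ennreal_mult mult.assoc)
  also have "\<dots> \<le> 2 * (\<Sum>j. ennreal (w j * (t j * g (c * t j))))"
  proof (intro mult_left_mono suminf_le)
    fix j
    show "ennreal (g F) * ennreal (if F \<le> c * t j then w j * t j else 0) \<le> ennreal (w j * (t j * g (c * t j)))"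
    proof (cases "F \<le> c * t j")
      case True
      then have "(w j * t j) * g F \<le> (w j * t j) * g (c * t j)"
        using g F w t by (intro mult_left_mono) auto
      then show ?thesis using True g(1)[OF F] w t
        by (auto simp: ennreal_mult[symmetric] mult_ac intro!: ennreal_leI)
    qed simp
  qed auto
  finally show ?thesis using F g(1)[OF F] by (simp add: ennreal_mult[symmetric] mult_ac)
qed

text \<open>With subtraction truncated at 0, \<open>norm (f x) - S x\<close> is below the norm of
  every remainder. Its integral is thus below a sequence tending to 0, so no almost everywhere
  convergent subsequence has to be extracted.\<close>

lemma AE_norm_le_suminf:
  fixes f :: "'a \<Rightarrow> complex" and u :: "nat \<Rightarrow> 'a \<Rightarrow> complex"
  assumes [measurable]: "f \<in> borel_measurable M" "\<And>j. u j \<in> borel_measurable M"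
    and lim: "(\<lambda>n. \<integral>\<^sup>+x. ennreal (norm (f x - (\<Sum>j<n. u j x))) \<partial>M) \<longlonglongrightarrow> 0"
  shows "AE x in M. ennreal (norm (f x)) \<le> (\<Sum>j. ennreal (norm (u j x)))"
proof -
  define S where "S = (\<lambda>x. \<Sum>j. ennreal (norm (u j x)))"
  have [measurable]: "S \<in> borel_measurable M" unfolding S_def by measurable
  have "ennreal (norm (f x)) - S x \<le> ennreal (norm (f x - (\<Sum>j<n. u j x)))" for n x
  proof -
    have "norm (f x) \<le> norm (f x - (\<Sum>j<n. u j x)) + norm (\<Sum>j<n. u j x)"
      using norm_triangle_sub[of "f x" "\<Sum>j<n. u j x"] by simp
    also have "\<dots> \<le> norm (f x - (\<Sum>j<n. u j x)) + (\<Sum>j<n. norm (u j x))"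
      by (intro add_left_mono norm_sum)
    finally have "ennreal (norm (f x)) \<le> ennreal (norm (f x - (\<Sum>j<n. u j x)) + (\<Sum>j<n. norm (u j x)))"
      by (rule ennreal_leI)
    also have "\<dots> = ennreal (norm (f x - (\<Sum>j<n. u j x))) + (\<Sum>j<n. ennreal (norm (u j x)))"
      by (simp add: ennreal_plus sum_nonneg)
    also have "\<dots> \<le> ennreal (norm (f x - (\<Sum>j<n. u j x))) + S x"
      unfolding S_def by (intro add_left_mono sum_le_suminf) auto
    finally show ?thesis by (simp add: ennreal_minus_le_iff add.commute)
  qed
  then have "(\<integral>\<^sup>+x. ennreal (norm (f x)) - S x \<partial>M) \<le> (\<integral>\<^sup>+x. ennreal (norm (f x - (\<Sum>j<n. u j x))) \<partial>M)" for n
    by (intro nn_integral_mono)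
  then have "(\<integral>\<^sup>+x. ennreal (norm (f x)) - S x \<partial>M) \<le> 0"
    by (intro LIMSEQ_le_const[OF lim]) auto
  then have "AE x in M. ennreal (norm (f x)) - S x = 0"
    by (subst nn_integral_0_iff_AE[symmetric]) auto
  then show ?thesis
    unfolding S_def by eventually_elim (auto simp: diff_eq_0_iff_ennreal not_less[symmetric] intro: less_imp_le)
qed

lemma block_space_subset_L_log_L:
  fixes M :: "'a measure"
  assumes q: "1 < q" and v: "-1 < v"
  shows "block_space M q v \<subseteq> L_log_L M (1 + v)"
proof
  fix f assume "f \<in> block_space M q v"
  then obtain l a E where f: "integrable M f" and blk: "\<And>j. generalized_block M q (E j) (a j)"
    and sm: "summable (\<lambda>j. norm (l j) * (1 + phi 0 v (measure M (E j))))"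
    and lim: "(\<lambda>n. \<integral>\<^sup>+x. ennreal (norm (f x - (\<Sum>j<n. l j * a j x))) \<partial>M) \<longlonglongrightarrow> 0"
    unfolding block_space_def by blast
  have a[measurable]: "a j \<in> borel_measurable M" for j
    using blk[of j] by (simp add: generalized_block_def)
  have fm[measurable]: "f \<in> borel_measurable M" using f by simp
  have phi_nonneg: "0 \<le> phi 0 v (measure M (E j))" for j
    using generalized_block_emeasure(2)[OF blk[of j]] v by (simp add: phi_zero_eq)
  define w where "w = (\<lambda>j. norm (l j))"
  have w: "0 \<le> w j" for j by (simp add: w_def)
  have sw: "summable w"
    by (rule summable_comparison_test'[OF sm, of 0]) (use phi_nonneg in \<open>auto simp: w_def algebra_simps\<close>)
  \<comment> \<open>The dilation depends on the coefficients of the decomposition, so the block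
    constant \<open>K\<close> is obtained only after \<open>c\<close>; it is still uniform in
    \<open>j\<close>.\<close>
  define c where "c = 2 * (1 + suminf w)"
  have c: "0 \<le> c" using suminf_nonneg[OF sw w] by (simp add: c_def)
  obtain K where K: "0 \<le> K" and bound: "\<And>(M :: 'a measure) E a. generalized_block M q E a \<Longrightarrow>
       (\<integral>\<^sup>+x. ennreal (norm (a x) * ln (2 + c * norm (a x)) powr (1 + v)) \<partial>M)
         \<le> ennreal (K * (1 + phi 0 v (measure M E)))"
    using block_L_log_L_bound[OF q v c] by blast
  have "AE x in M. ennreal (norm (f x)) \<le> (\<Sum>j. ennreal (norm (l j * a j x)))"
    by (rule AE_norm_le_suminf) (use lim in auto)
  then have "AE x in M. ennreal (norm (f x) * ln (2 + norm (f x)) powr (1 + v))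
      \<le> 2 * (\<Sum>j. ennreal (w j * (norm (a j x) * ln (2 + c * norm (a j x)) powr (1 + v))))"
  proof eventually_elim
    case (elim x)
    show ?case
    proof (rule mult_mono_fun_le_suminf[where g = "\<lambda>y. ln (2 + y) powr (1 + v)"])
      show "ennreal (norm (f x)) \<le> (\<Sum>j. ennreal (w j * norm (a j x)))"
        using elim by (simp add: w_def norm_mult)
      show "ln (2 + y) powr (1 + v) \<le> ln (2 + z) powr (1 + v)" if "0 \<le> y" "y \<le> z" for y z
        using that v by (intro powr_mono2 ln_mono) auto
    qed (use w sw c_def in auto)
  qed
  then have "(\<integral>\<^sup>+x. ennreal (norm (f x) * ln (2 + norm (f x)) powr (1 + v)) \<partial>M)
      \<le> (\<integral>\<^sup>+x. 2 * (\<Sum>j. ennreal (w j * (norm (a j x) * ln (2 + c * norm (a j x)) powr (1 + v)))) \<partial>M)"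
    by (rule nn_integral_mono_AE)
  also have "\<dots> = 2 * (\<Sum>j. ennreal (w j) * (\<integral>\<^sup>+x. ennreal (norm (a j x) * ln (2 + c * norm (a j x)) powr (1 + v)) \<partial>M))"
    using w by (simp add: nn_integral_cmult nn_integral_suminf ennreal_mult)
  also have "\<dots> \<le> 2 * (\<Sum>j. ennreal (w j) * ennreal (K * (1 + phi 0 v (measure M (E j)))))"
    by (intro mult_left_mono suminf_le bound blk) auto
  also have "\<dots> = 2 * (\<Sum>j. ennreal (K * (norm (l j) * (1 + phi 0 v (measure M (E j))))))"
    using K phi_nonneg by (simp add: ennreal_mult[symmetric] w_def mult_ac)
  also have "\<dots> = 2 * ennreal (\<Sum>j. K * (norm (l j) * (1 + phi 0 v (measure M (E j)))))"
    using K phi_nonneg by (subst suminf_ennreal2) (auto intro!: summable_mult sm)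
  also have "\<dots> < \<infinity>" by (simp add: ennreal_mult_less_top)
  finally show "f \<in> L_log_L M (1 + v)" by (simp add: L_log_L_def)
qed

section \<open>Dyadic decomposition on a space of finite measure\<close>

text \<open>The normalisation for \<open>q = \<infinity>\<close> suffices for every
  \<open>q\<close>: integrating \<open>(1 / m) powr p\<close> over \<open>E\<close> gives
  \<open>m powr (1 - p)\<close>, whose root of order \<open>p\<close> is the required bound.\<close>

lemma generalized_block_of_bounded:
  assumes a[measurable]: "a \<in> borel_measurable M" and E[measurable]: "E \<in> sets M"
    and "emeasure M E < \<infinity>" and m: "0 < measure M E" and q: "1 < q"
    and out: "\<And>x. x \<in> space M \<Longrightarrow> x \<notin> E \<Longrightarrow> a x = 0"
    and bd: "\<And>x. x \<in> E \<Longrightarrow> norm (a x) \<le> 1 / measure M E"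
  shows "generalized_block M q E a"
proof -
  define m where "m = measure M E"
  have em: "emeasure M E = ennreal m" and m0: "0 < m"
    using assms by (auto simp: m_def emeasure_eq_ennreal_measure less_top[symmetric])
  have ar[measurable]: "a \<in> borel_measurable (restrict_space M E)"
    using a by (rule measurable_restrict_space1)
  have Er: "E \<inter> space M \<in> sets M" by simp
  have "Lq_norm (restrict_space M E) q a \<le> ennreal (m powr (enn2real (1 / q) - 1))"
  proof (cases "q = \<infinity>")
    case True
    have "esssup (restrict_space M E) (\<lambda>x. ennreal (norm (a x))) \<le> ennreal (1 / m)"
      using bd by (intro esssup_I AE_I2) (auto simp: space_restrict_space m_def intro!: ennreal_leI)
    then show ?thesis using True m0 by (simp add: Lq_norm_def powr_minus divide_simps)
  next
    case False
    define p where "p = enn2real q"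
    have p1: "1 < p" using q False unfolding p_def by (cases q) auto
    have q0: "0 < q" using q by (meson less_trans zero_less_one)
    define I where "I = (\<integral>\<^sup>+x. ennreal (norm (a x) powr p) \<partial>restrict_space M E)"
    have "I \<le> (\<integral>\<^sup>+x. ennreal ((1 / m) powr p) \<partial>restrict_space M E)"
      unfolding I_def using bd p1
      by (intro nn_integral_mono ennreal_leI powr_mono2) (auto simp: space_restrict_space m_def)
    also have "\<dots> = ennreal ((1 / m) powr p) * ennreal m"
      by (simp add: space_restrict_space emeasure_restrict_space Er em
          Int_absorb2 sets.sets_into_space[OF E])
    also have "\<dots> = ennreal (m powr (1 - p))"
      using m0 by (simp add: ennreal_mult[symmetric] powr_diff powr_divide)
    finally have I: "I \<le> ennreal (m powr (1 - p))" .
    then have fin: "I \<noteq> \<infinity>" by (auto simp: top_unique)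
    have "enn2real I \<le> m powr (1 - p)" using I by (simp add: enn2real_leI)
    then have "enn2real I powr (1 / p) \<le> (m powr (1 - p)) powr (1 / p)"
      using p1 by (intro powr_mono2) auto
    also have "\<dots> = m powr (1 / p - 1)" using p1 by (simp add: powr_powr diff_divide_distrib)
    finally show ?thesis
      using fin False unfolding Lq_norm_def Let_def p_def[symmetric] I_def[symmetric]
      by (simp add: enn2real_one_divide q0 p_def[symmetric] ennreal_leI)
  qed
  then show ?thesis using assms m0 em by (simp add: generalized_block_def m_def)
qed

text \<open>The bound distinguishes \<open>1 / m \<le> 16 ^ k\<close>, where \<open>ln (1 / m) \<le> k * ln 16\<close>, from
  \<open>1 / m > 16 ^ k\<close>, where \<open>m * ln (1 / m) powr b\<close> is at most a multiple of \<open>sqrt m < 1 / 4 ^ k\<close>.\<close>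

lemma dyadic_log_bound:
  fixes b m :: real
  assumes b: "0 < b" and m: "0 < m"
  shows "2 ^ k * m * ln_plus (1 / m) powr b
    \<le> 2 ^ k * m * (real k * ln 16) powr b + (2 * b) powr b * (1 / 2) ^ k"
proof (cases "1 / m \<le> 16 ^ k")
  case True
  then have "ln (1 / m) \<le> ln (16 ^ k)" using m by (intro ln_mono) auto
  then have "ln_plus (1 / m) \<le> real k * ln 16" by (simp add: ln_plus_def ln_realpow)
  then have "ln_plus (1 / m) powr b \<le> (real k * ln 16) powr b"
    using b by (intro powr_mono2) (auto simp: ln_plus_def)
  then have "2 ^ k * m * ln_plus (1 / m) powr b \<le> 2 ^ k * m * (real k * ln 16) powr b"
    using m by (intro mult_left_mono) auto
  then show ?thesis by (simp add: add_increasing2)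
next
  case False
  have "(1::real) \<le> 16 ^ k" by simp
  with False have m1: "1 \<le> 1 / m" by linarith
  then have "ln_plus (1 / m) = ln (1 / m)" using m by (simp add: ln_plus_def)
  \<comment> \<open>The exponent 1/2 yields the constant \<open>(b / (1 / 2)) powr b\<close> and
    leaves \<open>sqrt m\<close>. The base 16 is chosen so that
    \<open>sqrt m \<le> 1 / 4 ^ k\<close>, which beats the factor \<open>2 ^ k\<close>.\<close>
  then have "ln_plus (1 / m) powr b \<le> (2 * b) powr b * (1 / m) powr (1 / 2)"
    using ln_powr_le_powr[OF m1 b, of "1 / 2"] by (simp add: mult.commute)
  then have "2 ^ k * m * ln_plus (1 / m) powr b \<le> 2 ^ k * m * ((2 * b) powr b * (1 / m) powr (1 / 2))"
    using m by (intro mult_left_mono) auto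
  also have "\<dots> = (2 * b) powr b * (2 ^ k * sqrt m)"
    using m by (simp add: powr_half_sqrt real_sqrt_divide field_simps)
  also have "\<dots> \<le> (2 * b) powr b * (1 / 2) ^ k"
  proof (intro mult_left_mono)
    have "m \<le> (1 / 4 ^ k)\<^sup>2"
      using False m by (simp add: power2_eq_square power_mult_distrib[symmetric] field_simps)
    then have "sqrt m \<le> 1 / 4 ^ k" by (intro real_le_lsqrt) auto
    then have "2 ^ k * sqrt m \<le> 2 ^ k * (1 / 4 ^ k)" by (intro mult_left_mono) auto
    also have "\<dots> = (1 / 2) ^ k" by (simp add: power_mult_distrib[symmetric] field_simps)
    finally show "2 ^ k * sqrt m \<le> (1 / 2) ^ k" .
  qed auto
  finally show ?thesis using m by (simp add: add_increasing)
qed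

lemma L_log_L_integrable:
  assumes f: "f \<in> L_log_L M b" and b: "0 < b"
  shows "integrable M f"
proof (rule integrableI_bounded)
  show "f \<in> borel_measurable M" using f by (simp add: L_log_L_def)
  then have [measurable]: "f \<in> borel_measurable M" .
  have "ennreal (norm (f x)) \<le> ennreal (1 / ln 2 powr b) * ennreal (norm (f x) * ln (2 + norm (f x)) powr b)" for x
  proof -
    have "ln 2 powr b \<le> ln (2 + norm (f x)) powr b"
      using b by (intro powr_mono2 ln_mono) (auto intro: add_pos_nonneg)
    then have "norm (f x) * ln 2 powr b \<le> norm (f x) * ln (2 + norm (f x)) powr b"
      by (rule mult_left_mono) simp
    then show ?thesis by (auto simp: ennreal_mult[symmetric] field_simps intro!: ennreal_leI)
  qed
  then have "(\<integral>\<^sup>+x. ennreal (norm (f x)) \<partial>M)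
      \<le> (\<integral>\<^sup>+x. ennreal (1 / ln 2 powr b) * ennreal (norm (f x) * ln (2 + norm (f x)) powr b) \<partial>M)"
    by (intro nn_integral_mono)
  also have "\<dots> < \<infinity>"
    using f by (simp add: nn_integral_cmult L_log_L_def ennreal_mult_less_top)
  finally show "(\<integral>\<^sup>+x. ennreal (norm (f x)) \<partial>M) < \<infinity>" .
qed

text \<open>On \<open>E k\<close> the weight \<open>2 ^ k * (1 + (real k * ln 16) powr b)\<close> is
  at most \<open>G x\<close>, a function independent of \<open>k\<close>. By disjointness the sum
  becomes a single integral of \<open>G\<close>, which is controlled by the L log L integrand plus a
  constant; finite measure takes care of the constant.\<close>

lemma dyadic_weights_summable:
  fixes f :: "'a \<Rightarrow> complex"
  assumes f: "f \<in> L_log_L M b" and b: "0 < b" and fin: "emeasure M (space M) < \<infinity>"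
    and E[measurable]: "\<And>k. E k \<in> sets M" and disj: "disjoint_family E"
    and lower: "\<And>k x. x \<in> E (Suc k) \<Longrightarrow> 2 ^ k \<le> norm (f x)"
  shows "summable (\<lambda>k. 2 ^ k * measure M (E k) * (1 + (real k * ln 16) powr b))"
proof (rule summable_suminf_not_top)
  have [measurable]: "f \<in> borel_measurable M" using f by (simp add: L_log_L_def)
  define L where "L = (\<lambda>x. ln (2 + norm (f x)) powr b)"
  define G where "G = (\<lambda>x. (1 + 2 * norm (f x)) * (1 + 8 powr b * L x))"
  have emE: "emeasure M (E k) = ennreal (measure M (E k))" for k
    using fin emeasure_mono[OF sets.sets_into_space[OF E[of k]] sets.top]
    by (intro emeasure_eq_ennreal_measure) (auto simp: top_unique)
  have G_lower: "2 ^ k * (1 + (real k * ln 16) powr b) \<le> G x" if "x \<in> E k" for k x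
    unfolding G_def
  proof (rule mult_mono)
    \<comment> \<open>The level set \<open>E k\<close> gives only \<open>2 ^ (k - 1)\<close> as a
      lower bound, hence the factor 2; the summand 1 covers \<open>k = 0\<close>, where there is no
      lower bound.\<close>
    show "2 ^ k \<le> 1 + 2 * norm (f x)"
      using lower[of x "k - 1"] that by (cases k) auto
    \<comment> \<open>For \<open>k = Suc i\<close>, the level gives \<open>i * ln 2\<close> and the
      2 inside the logarithm gives the missing \<open>ln 2\<close>. Together with
      \<open>ln 16 = 4 * ln 2\<close> this produces the 8.\<close>
    have "real k * ln 2 \<le> 2 * ln (2 + norm (f x))"
    proof (cases k)
      case (Suc i)
      have "ln (2 ^ i) \<le> ln (2 + norm (f x))" using lower[of x i] that Suc by (intro ln_mono) (auto intro: add_pos_nonneg)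
      moreover have "ln 2 \<le> ln (2 + norm (f x))" by (intro ln_mono) (auto intro: add_pos_nonneg)
      ultimately show ?thesis using Suc by (simp add: ln_realpow algebra_simps)
    qed simp
    moreover have "ln (16::real) = 4 * ln 2" using ln_realpow[of 2 4] by simp
    ultimately have "real k * ln 16 \<le> 8 * ln (2 + norm (f x))" by simp
    then have "(real k * ln 16) powr b \<le> (8 * ln (2 + norm (f x))) powr b"
      using b by (intro powr_mono2) auto
    then show "1 + (real k * ln 16) powr b \<le> 1 + 8 powr b * L x"
      by (simp add: L_def powr_mult)
  qed auto
  \<comment> \<open>Expanding \<open>G\<close>: the term \<open>2 * norm (f x)\<close> is absorbed
    using \<open>L x \<ge> ln 2 powr b\<close>, and a bare \<open>L x\<close> is at most
    \<open>ln 3 powr b\<close> where \<open>norm (f x) \<le> 1\<close> and at most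
    \<open>norm (f x) * L x\<close> elsewhere.\<close>
  define D where "D = 1 + 8 powr b * ln 3 powr b"
  define D' where "D' = 2 / ln 2 powr b + 3 * 8 powr b"
  have G_upper: "G x \<le> D + D' * (norm (f x) * L x)" for x
  proof -
    have "ln 2 powr b \<le> L x" unfolding L_def using b by (intro powr_mono2 ln_mono) (auto intro: add_pos_nonneg)
    then have "norm (f x) * ln 2 powr b \<le> norm (f x) * L x" by (rule mult_left_mono) simp
    then have 1: "2 * norm (f x) \<le> 2 / ln 2 powr b * (norm (f x) * L x)" by (simp add: field_simps)
    have 2: "L x \<le> ln 3 powr b + norm (f x) * L x"
    proof (cases "norm (f x) \<le> 1")
      case True
      then have "L x \<le> ln 3 powr b" unfolding L_def using b by (intro powr_mono2 ln_mono) (auto intro: add_pos_nonneg)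
      then show ?thesis by (simp add: L_def add_increasing2)
    next
      case False
      then have "1 * L x \<le> norm (f x) * L x" by (intro mult_right_mono) (auto simp: L_def)
      then show ?thesis by (simp add: add_increasing)
    qed
    then have "8 powr b * L x \<le> 8 powr b * (ln 3 powr b + norm (f x) * L x)"
      by (rule mult_left_mono) simp
    with 1 have "1 + 2 * norm (f x) + 8 powr b * L x + 2 * 8 powr b * (norm (f x) * L x)
        \<le> 1 + 2 / ln 2 powr b * (norm (f x) * L x) + 8 powr b * (ln 3 powr b + norm (f x) * L x)
          + 2 * 8 powr b * (norm (f x) * L x)"
      by (intro add_mono order_refl)
    then show ?thesis unfolding G_def D_def D'_def by (simp only: algebra_simps)
  qed
  have D: "0 \<le> D" "0 \<le> D'" by (auto simp: D_def D'_def)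
  have "(\<Sum>k. ennreal (2 ^ k * measure M (E k) * (1 + (real k * ln 16) powr b)))
      = (\<Sum>k. \<integral>\<^sup>+x. ennreal (2 ^ k * (1 + (real k * ln 16) powr b)) * indicator (E k) x \<partial>M)"
    by (simp only: nn_integral_cmult_indicator E emE)
      (simp add: ennreal_mult[symmetric] mult_ac)
  also have "\<dots> \<le> (\<Sum>k. \<integral>\<^sup>+x. ennreal (G x) * indicator (E k) x \<partial>M)"
    by (intro suminf_le nn_integral_mono) (auto simp: indicator_def intro!: ennreal_leI G_lower)
  also have "\<dots> = (\<integral>\<^sup>+x. ennreal (G x) * indicator (\<Union>k. E k) x \<partial>M)"
    by (rule nn_integral_disjoint_family[symmetric]) (use disj in \<open>auto simp: G_def L_def\<close>)
  also have "\<dots> \<le> (\<integral>\<^sup>+x. ennreal D + ennreal D' * ennreal (norm (f x) * L x) \<partial>M)"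
  proof (intro nn_integral_mono)
    fix x
    have "ennreal (G x) \<le> ennreal D + ennreal D' * ennreal (norm (f x) * L x)"
      using D G_upper[of x] by (auto simp: ennreal_mult[symmetric] ennreal_plus[symmetric] L_def
          simp del: ennreal_plus intro!: ennreal_leI)
    then show "ennreal (G x) * indicator (\<Union>k. E k) x \<le> ennreal D + ennreal D' * ennreal (norm (f x) * L x)"
      by (auto simp: indicator_def)
  qed
  also have "\<dots> = ennreal D * emeasure M (space M) + ennreal D' * (\<integral>\<^sup>+x. ennreal (norm (f x) * L x) \<partial>M)"
    by (simp add: nn_integral_add nn_integral_cmult L_def)
  also have "\<dots> < \<infinity>"
    using f fin by (simp add: L_log_L_def L_def ennreal_mult_less_top)
  finally show "(\<Sum>k. ennreal (2 ^ k * measure M (E k) * (1 + (real k * ln 16) powr b))) \<noteq> top"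
    by auto
qed auto

lemma L_log_L_subset_block_space:
  fixes M :: "'a measure"
  assumes q: "1 < q" and v: "-1 < v"
    and ne: "emeasure M (space M) \<noteq> 0" and fin: "emeasure M (space M) < \<infinity>"
  shows "L_log_L M (1 + v) \<subseteq> block_space M q v"
proof
  fix f assume fL: "f \<in> L_log_L M (1 + v)"
  define b where "b = 1 + v"
  have b: "0 < b" using v by (simp add: b_def)
  have int: "integrable M f" using L_log_L_integrable[OF fL] v by simp
  then have [measurable]: "f \<in> borel_measurable M" by simp
  interpret finite_measure M using fin by (intro finite_measureI) auto
  \<comment> \<open>\<open>E 0\<close> is the set where \<open>norm (f x) < 1\<close>, and
    \<open>E (Suc k)\<close> the one where
    \<open>2 ^ k \<le> norm (f x) < 2 ^ Suc k\<close>.\<close>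
  define A where "A = (\<lambda>k::nat. {x \<in> space M. norm (f x) < 2 ^ k})"
  define E where "E = disjointed A"
  have A[measurable]: "A k \<in> sets M" for k unfolding A_def by measurable
  have E[measurable]: "E k \<in> sets M" for k
    unfolding E_def using sets.range_disjointed_sets[of A M] A by blast
  have disj: "disjoint_family E" unfolding E_def by (rule disjoint_family_disjointed)
  have upper: "norm (f x) \<le> 2 ^ k" "x \<in> space M" if "x \<in> E k" for x k
    using that by (auto simp: E_def disjointed_def A_def)
  have lower: "2 ^ k \<le> norm (f x)" if "x \<in> E (Suc k)" for x k
    using that by (auto simp: E_def disjointed_def A_def not_less)
  define m where "m = (\<lambda>k. measure M (E k))"
  have m: "0 \<le> m k" for k by (simp add: m_def)
  define l where "l = (\<lambda>k. complex_of_real (2 ^ k * m k))"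
  define a where "a = (\<lambda>k x. if m k = 0 then 0 else f x * indicator (E k) x / l k)"
  \<comment> \<open>A block needs a support of positive measure. For a null level set the zero
    function on the whole space is taken, with coefficient 0.\<close>
  define S where "S = (\<lambda>k. if m k = 0 then space M else E k)"
  have blk: "generalized_block M q (S k) (a k)" for k
  proof (rule generalized_block_of_bounded)
    show "a k \<in> borel_measurable M" unfolding a_def by measurable
    show "S k \<in> sets M" by (simp add: S_def)
    show "emeasure M (S k) < \<infinity>" by (simp add: emeasure_eq_measure)
    show "0 < measure M (S k)"
      using ne m[of k] by (auto simp: S_def m_def emeasure_eq_measure zero_less_measure_iff)
    show "norm (a k x) \<le> 1 / measure M (S k)" if "x \<in> S k" for x
    proof (cases "m k = 0")
      case False
      then have "norm (a k x) = norm (f x) / (2 ^ k * m k)"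
        using that m[of k] by (simp add: a_def S_def l_def norm_divide norm_mult norm_power)
      also have "\<dots> \<le> 2 ^ k / (2 ^ k * m k)"
        using upper that False m[of k] by (intro divide_right_mono) (auto simp: S_def)
      finally show ?thesis using False by (simp add: S_def m_def)
    qed (simp add: a_def)
  qed (use q in \<open>auto simp: a_def S_def\<close>)
  have sum1: "summable (\<lambda>k. 2 ^ k * m k * (1 + (real k * ln 16) powr b))"
    unfolding m_def using fL b fin E disj lower by (intro dyadic_weights_summable) (auto simp: b_def)
  have "summable (\<lambda>k. norm (l k) * (1 + phi 0 v (measure M (S k))))"
  proof (rule summable_comparison_test'[of _ 0])
    \<comment> \<open>The majorant is \<open>dyadic_log_bound\<close> divided by \<open>b\<close>,
      as in \<open>phi\<close>, plus the term \<open>2 ^ k * m k\<close>; the geometric part comes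
      from level sets of very small measure.\<close>
    show "summable (\<lambda>k. (1 + 1 / b) * (2 ^ k * m k * (1 + (real k * ln 16) powr b)) + (2 * b) powr b / b * (1 / 2) ^ k)"
      by (intro summable_add summable_mult sum1 summable_geometric) auto
    show "norm (norm (l k) * (1 + phi 0 v (measure M (S k))))
      \<le> (1 + 1 / b) * (2 ^ k * m k * (1 + (real k * ln 16) powr b)) + (2 * b) powr b / b * (1 / 2) ^ k" for k
    proof (cases "m k = 0")
      case False
      then have mk: "0 < m k" using m[of k] by simp
      have "norm (l k) = 2 ^ k * m k" using m by (simp add: l_def norm_mult norm_power)
      moreover have "measure M (S k) = m k" using False by (simp add: S_def m_def)
      moreover have "phi 0 v (m k) = ln_plus (1 / m k) powr b / b"
        using phi_zero_eq[OF v mk] by (simp add: b_def)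
      ultimately have "norm (norm (l k) * (1 + phi 0 v (measure M (S k)))) = 2 ^ k * m k + 2 ^ k * m k * ln_plus (1 / m k) powr b / b"
        using mk b by (simp add: abs_of_nonneg distrib_left)
      also have "\<dots> \<le> 2 ^ k * m k + (2 ^ k * m k * (real k * ln 16) powr b + (2 * b) powr b * (1 / 2) ^ k) / b"
        using b by (intro add_left_mono divide_right_mono dyadic_log_bound mk) auto
      also have "\<dots> \<le> (1 + 1 / b) * (2 ^ k * m k * (1 + (real k * ln 16) powr b)) + (2 * b) powr b / b * (1 / 2) ^ k"
        using b mk by (simp add: field_simps)
      finally show ?thesis .
    qed (use b in \<open>simp add: l_def\<close>)
  qed
  moreover have "(\<lambda>n. \<integral>\<^sup>+x. ennreal (norm (f x - (\<Sum>j<n. l j * a j x))) \<partial>M) \<longlonglongrightarrow> 0"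
  proof -
    have "AE x in M. \<forall>k. m k = 0 \<longrightarrow> x \<notin> E k"
      unfolding AE_all_countable
    proof
      fix k
      show "AE x in M. m k = 0 \<longrightarrow> x \<notin> E k"
      proof (cases "m k = 0")
        case True
        then have "E k \<in> null_sets M" by (simp add: m_def null_sets_def emeasure_eq_measure)
        then show ?thesis using AE_not_in by fastforce
      qed simp
    qed
    \<comment> \<open>On null level sets the zero block replaces \<open>f\<close>, so the formula
      for the remainder holds off a countable union of null sets, the same for all \<open>n\<close>.
      The remainder vanishes at a point once \<open>n\<close> exceeds its level, and dominated
      convergence applies.\<close>
    then have rep: "AE x in M. \<forall>n. f x - (\<Sum>j<n. l j * a j x) = f x * (1 - indicator (\<Union>j<n. A j) x)"
    proof eventually_elim
      case (elim x)
      have "l j * a j x = f x * indicator (E j) x" for j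
        using elim by (auto simp: a_def l_def indicator_def)
      moreover have "(\<Sum>j<n. indicator (E j) x) = (indicator (\<Union>j<n. A j) x :: complex)" for n
      proof -
        have "(\<Union>j<n. A j) = (\<Union>j<n. E j)"
          using finite_UN_disjointed_eq[of A n] by (simp add: E_def lessThan_atLeast0)
        moreover have "disjoint_family_on E {..<n}" using disj by (auto simp: disjoint_family_on_def)
        ultimately show ?thesis by (simp add: indicator_UN_disjoint)
      qed
      ultimately show ?case by (simp add: sum_distrib_left[symmetric] algebra_simps)
    qed
    have "(\<lambda>n. \<integral>\<^sup>+x. ennreal (norm (f x * (1 - indicator (\<Union>j<n. A j) x))) \<partial>M) \<longlonglongrightarrow> (\<integral>\<^sup>+x. 0 \<partial>M)"
    proof (rule nn_integral_dominated_convergence[where w = "\<lambda>x. ennreal (norm (f x))"])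
      show "(\<integral>\<^sup>+x. ennreal (norm (f x)) \<partial>M) < \<infinity>" using int by (simp add: integrable_iff_bounded)
      show "AE x in M. (\<lambda>n. ennreal (norm (f x * (1 - indicator (\<Union>j<n. A j) x)))) \<longlonglongrightarrow> 0"
      proof (rule AE_I2)
        fix x assume x: "x \<in> space M"
        obtain k where "norm (f x) < 2 ^ k" using real_arch_pow[of 2 "norm (f x)"] by auto
        then have "x \<in> A k" using x by (simp add: A_def)
        then have "eventually (\<lambda>n. ennreal (norm (f x * (1 - indicator (\<Union>j<n. A j) x))) = 0) sequentially"
          by (auto simp: eventually_sequentially indicator_def intro!: exI[of _ "Suc k"])
        then show "(\<lambda>n. ennreal (norm (f x * (1 - indicator (\<Union>j<n. A j) x)))) \<longlonglongrightarrow> 0"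
          by (rule tendsto_eventually)
      qed
    qed (auto simp: indicator_def)
    moreover have "(\<integral>\<^sup>+x. ennreal (norm (f x - (\<Sum>j<n. l j * a j x))) \<partial>M)
        = (\<integral>\<^sup>+x. ennreal (norm (f x * (1 - indicator (\<Union>j<n. A j) x))) \<partial>M)" for n
      by (rule nn_integral_cong_AE) (use rep in eventually_elim, auto)
    ultimately show ?thesis by simp
  qed
  ultimately show "f \<in> block_space M q v"
    using int blk unfolding block_space_def by blast
qed

theorem theorem1p9:
  fixes M :: "'a measure" and d :: "'a \<Rightarrow> 'a \<Rightarrow> real" and s v :: real and q :: ennreal
  assumes "ahlfors_regular_space M d s" and "1 < q" and "-1 < v"
  shows "block_space M q v \<subseteq> L_log_L M (1 + v) \<and>
    (emeasure M (space M) < \<infinity> \<longrightarrow> block_space M q v = L_log_L M (1 + v))"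
proof (intro conjI impI)
  show sub: "block_space M q v \<subseteq> L_log_L M (1 + v)"
    using assms by (intro block_space_subset_L_log_L)
  assume "emeasure M (space M) < \<infinity>"
  then show "block_space M q v = L_log_L M (1 + v)"
    \<comment> \<open>Regularity supplies the nonzero total measure, which makes the whole space an
      admissible support for the zero blocks.\<close>
    using assms sub by (intro antisym L_log_L_subset_block_space) (auto simp: ahlfors_regular_space_def)
qed

end
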